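(* Let $(\Omega,\mathcal{F},\mathbb{P})$ be a nonatomic probability space and $\alpha\in(0,1)$. Consider a traded asset $S=(S_0,S_T)$ and assume $\rho_{\mathscr{A}_\alpha,S}$ is finitely valued. The following two statements are equivalent: (a) $\rho_{\mathscr{A}_\alpha,S}$ is continuous on $\mathscr{X}$; (b) $S_T$ is essentially bounded away from zero.
   Context: A probability space is nonatomic if it has no atoms, i.e. no set $A\in\mathcal{F}$ with $\mathbb{P}[A]>0$ such that $\mathbb{P}[B]=0$ or $\mathbb{P}[B]=\mathbb{P}[A]$ for every measurable $B\subset A$. $\mathscr{X}$ is the Banach space of bounded $\mathcal{F}$-measurable functions $X:\Omega\to\mathbb{R}$ with the supremum norm and the pointwise order (functions are not identified almost surely); $\mathscr{X}_+=\{X\in\mathscr{X}: X\ge 0\}$. $X\in\mathscr{X}$ is essentially bounded away from zero if $\mathbb{P}[X\ge\varepsilon]=1$ for some $\varepsilon>0$. For $\alpha\in(0,1)$ and $X\in\mathscr{X}$, $\mathrm{VaR}_\alpha(X)=\inf\{m\in\mathbb{R}:\mathbb{P}[X+m<0]\le\alpha\}$, and $\mathscr{A}_\alpha=\{X\in\mathscr{X}:\mathrm{VaR}_\alpha(X)\le 0\}=\{X\in\mathscr{X}:\mathbb{P}[X<0]\le\alpha\}$. A traded asset is a pair $S=(S_0,S_T)$ with $S_0\in\mathbb{R}$, $S_0>0$, and $S_T\in\mathscr{X}_+$, $S_T\ne 0$. For $\mathscr{A}\subset\mathscr{X}$, $\rho_{\mathscr{A},S}:\mathscr{X}\to\mathbb{R}\cup\{-\infty,\infty\}$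 is $\rho_{\mathscr{A},S}(X)=\inf\{m\in\mathbb{R}: X+\frac{m}{S_0}S_T\in\mathscr{A}\}$ (with $\inf\emptyset=\infty$). It is finitely valued if $\rho_{\mathscr{A},S}(X)\in\mathbb{R}$ for every $X\in\mathscr{X}$. *)

theory Defs
  imports "HOL-Probability.Probability"
begin

definition atom :: "'a measure \<Rightarrow> 'a set \<Rightarrow> bool" where
  "atom M A \<longleftrightarrow> A \<in> sets M \<and> measure M A > 0 \<and>
     (\<forall>B\<in>sets M. B \<subseteq> A \<longrightarrow> measure M B = 0 \<or> measure M B = measure M A)"

definition nonatomic :: "'a measure \<Rightarrow> bool" where
  "nonatomic M \<longleftrightarrow> (\<nexists>A. atom M A)"

text \<open>
  The space of bounded measurable functions, without almost-sure identification, with the metric of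
  the supremum norm. As always with \<^const>\<open>funspace\<close>, functions on \<open>\<Omega> = space M\<close> are represented by
  their extensional representatives (value \<^const>\<open>undefined\<close> outside \<^term>\<open>space M\<close>), so
  that equality is pointwise equality on \<open>\<Omega>\<close>. Sums, multiples and constants therefore have to be
  restricted to \<^term>\<open>space M\<close>.
\<close>

definition bounded_rv :: "'a measure \<Rightarrow> ('a \<Rightarrow> real) metric" where
  "bounded_rv M = submetric (funspace (space M) euclidean_metric) (borel_measurable M)"

lemma mspace_bounded_rv:
  "X \<in> mspace (bounded_rv M) \<longleftrightarrow>
     X \<in> borel_measurable M \<and> X \<in> extensional (space M) \<and> bounded (X ` space M)"
  by (auto simp: bounded_rv_def Met_TC.fspace_def)

lemma mdist_bounded_rv:
  assumes "X \<in> mspace (bounded_rv M)" "Y \<in> mspace (bounded_rv M)" "space M \<noteq> {}"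
  shows "mdist (bounded_rv M) X Y = (SUP \<omega>\<in>space M. \<bar>X \<omega> - Y \<omega>\<bar>)"
  using assms by (simp add: bounded_rv_def Met_TC.fdist_def dist_real_def)

definition ess_bounded_away_from_zero :: "'a measure \<Rightarrow> ('a \<Rightarrow> real) \<Rightarrow> bool" where
  "ess_bounded_away_from_zero M X \<longleftrightarrow> (\<exists>\<epsilon>>0. measure M {\<omega>\<in>space M. X \<omega> \<ge> \<epsilon>} = 1)"

text \<open>
  Infima are taken in the extended reals, so that \<open>Inf {} = \<infinity>\<close>. For a bounded random
  variable on a probability space and \<open>0 < \<alpha> < 1\<close>, the value at risk is a real number.
\<close>

definition VaR :: "'a measure \<Rightarrow> real \<Rightarrow> ('a \<Rightarrow> real) \<Rightarrow> ereal" where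
  "VaR M \<alpha> X = Inf {ereal m | m. measure M {\<omega>\<in>space M. X \<omega> + m < 0} \<le> \<alpha>}"

definition acceptance_VaR :: "'a measure \<Rightarrow> real \<Rightarrow> ('a \<Rightarrow> real) set" where
  "acceptance_VaR M \<alpha> = {X \<in> mspace (bounded_rv M). VaR M \<alpha> X \<le> 0}"

text \<open>An asset is the pair of its initial price and its terminal payoff.\<close>

definition traded_asset :: "'a measure \<Rightarrow> real \<times> ('a \<Rightarrow> real) \<Rightarrow> bool" where
  "traded_asset M = (\<lambda>(S0, ST). S0 > 0 \<and> ST \<in> mspace (bounded_rv M) \<and>
     (\<forall>\<omega>\<in>space M. ST \<omega> \<ge> 0) \<and> (\<exists>\<omega>\<in>space M. ST \<omega> \<noteq> 0))"

definition risk_measure ::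
  "'a measure \<Rightarrow> ('a \<Rightarrow> real) set \<Rightarrow> real \<times> ('a \<Rightarrow> real) \<Rightarrow> ('a \<Rightarrow> real) \<Rightarrow> ereal" where
  "risk_measure M \<A> = (\<lambda>(S0, ST) X.
     Inf {ereal m | m. (\<lambda>\<omega>\<in>space M. X \<omega> + m / S0 * ST \<omega>) \<in> \<A>})"

definition finitely_valued :: "'a measure \<Rightarrow> (('a \<Rightarrow> real) \<Rightarrow> ereal) \<Rightarrow> bool" where
  "finitely_valued M \<rho> \<longleftrightarrow> (\<forall>X\<in>mspace (bounded_rv M). \<bar>\<rho> X\<bar> \<noteq> \<infinity>)"

end

theory Submission
  imports Defs
begin

text \<open>
  If \<open>S\<^sub>T \<ge> \<epsilon>\<close> almost surely, then a perturbation of the position by at most \<open>d\<close> is compensated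
  by \<open>S\<^sub>0 d / \<epsilon>\<close> additional units of capital, so the risk measure is Lipschitz continuous.
  Conversely, finiteness at the constant \<open>1\<close> forces \<open>P[S\<^sub>T > 0] > \<alpha>\<close>, so nonatomicity
  yields a set \<open>D\<close> of probability exactly \<open>\<alpha>\<close> on which \<open>S\<^sub>T\<close> is bounded away from zero.
  For large \<open>L\<close> the position \<open>X = -L 1\<^sub>D\<close> has risk at most \<open>0\<close>. If \<open>S\<^sub>T\<close> is not essentially
  bounded away from zero, then for every \<open>\<delta> > 0\<close> and \<open>m \<le> 1\<close> the payoff \<open>X - \<delta> + m S\<^sub>T / S\<^sub>0\<close> is
  negative on \<open>D\<close> and also on a set of positive probability disjoint from \<open>D\<close> where \<open>S\<^sub>T\<close> is
  small, so the risk of \<open>X - \<delta>\<close> is at least \<open>1\<close>.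
\<close>

section \<open>Nonatomic measures\<close>

text \<open>A set of positive measure is not an atom, so it splits into two pieces of positive
  measure, and one of them carries at most half of the total. Iterating this drives the measure
  below any bound while it stays positive.\<close>

lemma (in finite_measure) nonatomic_small_subset:
  assumes "nonatomic M" "A \<in> sets M" "0 < measure M A" "0 < e"
  obtains B where "B \<in> sets M" "B \<subseteq> A" "0 < measure M B" "measure M B < e"
proof -
  have halve: "\<exists>B\<in>sets M. B \<subseteq> A \<and> 0 < measure M B \<and> measure M B \<le> measure M A / 2"
    if A: "A \<in> sets M" "0 < measure M A" for A
  proof -
    have "\<not> atom M A"
      using assms(1) by (auto simp: nonatomic_def)
    then obtain B where B: "B \<in> sets M" "B \<subseteq> A" "measure M B \<noteq> 0" "measure M B \<noteq> measure M A"
      using A unfolding atom_def by blast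
    have "measure M (A - B) = measure M A - measure M B"
      using A B by (simp add: finite_measure_Diff)
    moreover have "measure M B \<le> measure M A" "0 \<le> measure M B"
      using A B by (auto intro: finite_measure_mono)
    ultimately show ?thesis
      using A B by (cases "measure M B \<le> measure M A / 2")
        (auto intro: bexI[of _ B] bexI[of _ "A - B"] simp: less_le)
  qed
  have "\<exists>B\<in>sets M. B \<subseteq> A \<and> 0 < measure M B \<and> measure M B \<le> measure M A * (1/2) ^ n" for n
  proof (induction n)
    case 0
    then show ?case using assms by auto
  next
    case (Suc n)
    then obtain B where B: "B \<in> sets M" "B \<subseteq> A" "0 < measure M B"
      "measure M B \<le> measure M A * (1/2) ^ n" by blast
    obtain C where "C \<in> sets M" "C \<subseteq> B" "0 < measure M C" "measure M C \<le> measure M B / 2"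
      using halve[OF B(1,3)] by blast
    then show ?case using B by (intro bexI[of _ C]) auto
  qed
  moreover obtain n where "(1/2::real) ^ n < e / measure M A"
    using real_arch_pow_inv[of "e / measure M A" "1/2"] assms by auto
  ultimately obtain B where "B \<in> sets M" "B \<subseteq> A" "0 < measure M B"
    "measure M B \<le> measure M A * (1/2) ^ n" "measure M A * (1/2) ^ n < e"
    using assms(3) by (auto simp: field_simps)
  then show ?thesis using that[of B] by linarith
qed

text \<open>
  Sierpinski's theorem. A greedy exhaustion: each step realises at least half of the largest
  possible increase of measure.
\<close>

lemma (in finite_measure) nonatomic_subset_of_measure:
  assumes "nonatomic M" "C \<in> sets M" "0 \<le> a" "a \<le> measure M C"
  obtains D where "D \<in> sets M" "D \<subseteq> C" "measure M D = a"
proof -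
  define adm where "adm D \<longleftrightarrow> D \<in> sets M \<and> D \<subseteq> C \<and> measure M D \<le> a" for D
  define greedy where "greedy D D' \<longleftrightarrow> D \<subseteq> D' \<and>
    (\<forall>B. adm B \<longrightarrow> D \<subseteq> B \<longrightarrow> measure M B - measure M D \<le> 2 * (measure M D' - measure M D))"
    for D D'
  have step: "\<exists>D'. adm D' \<and> greedy D D'" if D: "adm D" for D
  proof -
    define V where "V = measure M ` {B. adm B \<and> D \<subseteq> B}"
    have V: "measure M D \<in> V" "bdd_above V"
      using D by (auto simp: V_def adm_def bdd_above_def)
    have le: "measure M D \<le> Sup V" by (rule cSup_upper) (use V in auto)
    \<comment> \<open>The supremum need not be attained, so \<open>D'\<close> only has to reach the
      midpoint between the current measure and \<open>Sup V\<close>. This is where the factor 2 in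
      \<open>greedy\<close> comes from. If nothing can be gained, \<open>D\<close> itself
      serves.\<close>
    obtain D' where D': "adm D'" "D \<subseteq> D'" "(Sup V + measure M D) / 2 \<le> measure M D'"
    proof (cases "measure M D = Sup V")
      case True
      then show ?thesis using that[of D] D by auto
    next
      case False
      then have "(Sup V + measure M D) / 2 < Sup V" using le by auto
      then obtain v where "v \<in> V" "(Sup V + measure M D) / 2 < v"
        using less_cSupD[of V] V(1) by blast
      then show ?thesis using that by (auto simp: V_def)
    qed
    have "measure M B \<le> Sup V" if "adm B" "D \<subseteq> B" for B
      by (rule cSup_upper) (use V that in \<open>auto simp: V_def\<close>)
    with D' show ?thesis
      unfolding greedy_def by (intro exI[of _ D']) (fastforce simp: field_simps)
  qed
  have "adm {}" using assms by (auto simp: adm_def)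
  then obtain D where adm: "\<And>n. adm (D n)" and greedy: "\<And>n. greedy (D n) (D (Suc n))"
    using dependent_nat_choice[of "\<lambda>_. adm" "\<lambda>_. greedy"] step by blast
  have D: "range D \<subseteq> sets M" "\<And>n. D n \<subseteq> C" "\<And>n. measure M (D n) \<le> a"
    using adm by (auto simp: adm_def)
  have "incseq D" using greedy by (intro incseq_SucI) (auto simp: greedy_def)
  then have lim: "(\<lambda>n. measure M (D n)) \<longlonglongrightarrow> measure M (\<Union>n. D n)"
    using D by (intro finite_Lim_measure_incseq) auto
  have le: "measure M (\<Union>n. D n) \<le> a"
    using lim D(3) by (intro LIMSEQ_le_const2) auto
  have meas: "(\<Union>n. D n) \<in> sets M" using D by auto
  have "measure M (\<Union>n. D n) = a"
  proof (rule ccontr)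
    assume "measure M (\<Union>n. D n) \<noteq> a"
    with le have less: "measure M (\<Union>n. D n) < a" by simp
    have "measure M (C - (\<Union>n. D n)) = measure M C - measure M (\<Union>n. D n)"
      using D assms meas by (intro finite_measure_Diff) auto
    then have pos: "0 < measure M (C - (\<Union>n. D n))" using less assms by simp
    \<comment> \<open>If the limit misses \<open>a\<close>, the rest of \<open>C\<close> contains a
      set \<open>B\<close> of positive measure that fits into the gap.\<close>
    obtain B where B: "B \<in> sets M" "B \<subseteq> C - (\<Union>n. D n)" "0 < measure M B"
        "measure M B < a - measure M (\<Union>n. D n)"
      by (rule nonatomic_small_subset[OF assms(1) _ pos, of "a - measure M (\<Union>n. D n)"])
        (use less assms meas in auto)
    \<comment> \<open>The same \<open>B\<close> can be added to every \<open>D n\<close> without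
      exceeding \<open>a\<close>, so each greedy step gains at least half of its measure. The
      measures of the \<open>D n\<close> would then grow without bound.\<close>
    have inc: "measure M B \<le> 2 * (measure M (D (Suc n)) - measure M (D n))" for n
    proof -
      have eq: "measure M (D n \<union> B) = measure M (D n) + measure M B"
        using D B by (intro finite_measure_Union) auto
      moreover have "measure M (D n) \<le> measure M (\<Union>n. D n)"
        using D meas by (intro finite_measure_mono) auto
      ultimately have "adm (D n \<union> B)" using D B unfolding adm_def by auto
      with greedy[of n] eq show ?thesis unfolding greedy_def by force
    qed
    have "real n * (measure M B / 2) \<le> measure M (D n)" for n
    proof (induction n)
      case (Suc n)
      then show ?case using inc[of n] by (simp add: field_simps)
    qed simp
    then have "real n * (measure M B / 2) \<le> a" for n using D(3) order_trans by blast
    then show False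
      using reals_Archimedean3[of "measure M B / 2"] B(3) by (auto simp: not_less[symmetric])
  qed
  then show ?thesis using that[of "\<Union>n. D n"] D meas by auto
qed

section \<open>Acceptability and risk\<close>

lemma restrict_in_bounded_rv:
  assumes "f \<in> borel_measurable M" "\<And>\<omega>. \<omega> \<in> space M \<Longrightarrow> \<bar>f \<omega>\<bar> \<le> b"
  shows "restrict f (space M) \<in> mspace (bounded_rv M)"
proof -
  have "restrict f (space M) \<in> borel_measurable M"
    using assms(1) by (simp add: measurable_restrict_space2_iff cong: measurable_cong)
  moreover have "bounded (restrict f (space M) ` space M)"
    using assms(2) by (auto simp: bounded_iff)
  ultimately show ?thesis by (auto simp: mspace_bounded_rv)
qed

lemma bounded_rvE:
  assumes "X \<in> mspace (bounded_rv M)"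
  obtains b where "0 < b" "\<And>\<omega>. \<omega> \<in> space M \<Longrightarrow> \<bar>X \<omega>\<bar> \<le> b"
  using assms by (auto simp: mspace_bounded_rv bounded_pos)

lemma abs_diff_le_mdist_bounded_rv:
  assumes "X \<in> mspace (bounded_rv M)" "Y \<in> mspace (bounded_rv M)" "\<omega> \<in> space M"
  shows "\<bar>X \<omega> - Y \<omega>\<bar> \<le> mdist (bounded_rv M) X Y"
proof -
  obtain a b where ab: "\<And>\<omega>. \<omega> \<in> space M \<Longrightarrow> \<bar>X \<omega>\<bar> \<le> a" "\<And>\<omega>. \<omega> \<in> space M \<Longrightarrow> \<bar>Y \<omega>\<bar> \<le> b"
    using assms(1,2) by (metis bounded_rvE)
  have "bdd_above ((\<lambda>\<omega>. \<bar>X \<omega> - Y \<omega>\<bar>) ` space M)"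
  proof (rule bdd_aboveI2)
    fix \<omega> assume "\<omega> \<in> space M"
    then show "\<bar>X \<omega> - Y \<omega>\<bar> \<le> a + b" using ab[of \<omega>] by linarith
  qed
  moreover have "space M \<noteq> {}" using assms(3) by auto
  ultimately show ?thesis
    using assms by (subst mdist_bounded_rv) (auto intro!: cSUP_upper)
qed

context prob_space
begin

text \<open>The level 0 is admissible even when it is only the infimum of admissible levels: every
  event \<open>X + 1/(n+1) < 0\<close> has probability at most \<alpha>, these events increase to
  \<open>X < 0\<close>, and continuity from below passes to the limit.\<close>

lemma VaR_le_0_iff:
  assumes X[measurable]: "X \<in> borel_measurable M"
  shows "VaR M \<alpha> X \<le> 0 \<longleftrightarrow> prob {\<omega>\<in>space M. X \<omega> < 0} \<le> \<alpha>"
proof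
  assume "prob {\<omega>\<in>space M. X \<omega> < 0} \<le> \<alpha>"
  then show "VaR M \<alpha> X \<le> 0"
    unfolding VaR_def by (intro Inf_lower) (auto simp: zero_ereal_def)
next
  assume var: "VaR M \<alpha> X \<le> 0"
  define F where "F n = {\<omega>\<in>space M. X \<omega> + inverse (real (Suc n)) < 0}" for n
  have F: "prob (F n) \<le> \<alpha>" for n
  proof -
    have "VaR M \<alpha> X < ereal (inverse (real (Suc n)))"
      using var by (rule le_less_trans) simp
    then obtain m where m: "prob {\<omega>\<in>space M. X \<omega> + m < 0} \<le> \<alpha>" "m < inverse (real (Suc n))"
      unfolding VaR_def Inf_less_iff by auto
    have "prob (F n) \<le> prob {\<omega>\<in>space M. X \<omega> + m < 0}"
      unfolding F_def by (rule finite_measure_mono) (use m in auto)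
    with m show ?thesis by simp
  qed
  have "incseq F"
  proof (rule incseq_SucI)
    fix n
    have "X \<omega> + inverse (real (Suc (Suc n))) \<le> X \<omega> + inverse (real (Suc n))" for \<omega>
      by (simp add: field_simps)
    then show "F n \<le> F (Suc n)"
      unfolding F_def by (blast intro: le_less_trans)
  qed
  moreover have "range F \<subseteq> sets M" unfolding F_def by auto
  ultimately have "(\<lambda>n. prob (F n)) \<longlonglongrightarrow> prob (\<Union>n. F n)"
    by (intro finite_Lim_measure_incseq)
  moreover have "(\<Union>n. F n) = {\<omega>\<in>space M. X \<omega> < 0}"
  proof (intro equalityI subsetI)
    fix \<omega> assume "\<omega> \<in> (\<Union>n. F n)"
    then obtain n where "\<omega> \<in> space M" "X \<omega> + inverse (real (Suc n)) < 0" by (auto simp: F_def)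
    moreover have "0 < inverse (real (Suc n))" by simp
    ultimately have "\<omega> \<in> space M" "X \<omega> < 0" by linarith+
    then show "\<omega> \<in> {\<omega>\<in>space M. X \<omega> < 0}" by simp
  next
    fix \<omega> assume \<omega>: "\<omega> \<in> {\<omega>\<in>space M. X \<omega> < 0}"
    then obtain n where "inverse (real (Suc n)) < - X \<omega>"
      using reals_Archimedean[of "- X \<omega>"] by auto
    then have "\<omega> \<in> F n" using \<omega> by (auto simp: F_def)
    then show "\<omega> \<in> (\<Union>n. F n)" by blast
  qed
  ultimately show "prob {\<omega>\<in>space M. X \<omega> < 0} \<le> \<alpha>"
    using F by (intro LIMSEQ_le_const2[where X = "\<lambda>n. prob (F n)"]) auto
qed

text \<open>Removes both the value at risk and the restriction to \<open>space M\<close>, so that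
  risks can be compared through probabilities of losses alone.\<close>

lemma risk_measure_acceptance_VaR:
  assumes X: "X \<in> mspace (bounded_rv M)" and ST: "ST \<in> mspace (bounded_rv M)"
  shows "risk_measure M (acceptance_VaR M \<alpha>) (S0, ST) X =
    Inf {ereal m | m. prob {\<omega>\<in>space M. X \<omega> + m / S0 * ST \<omega> < 0} \<le> \<alpha>}"
proof -
  have "(\<lambda>\<omega>\<in>space M. X \<omega> + m / S0 * ST \<omega>) \<in> acceptance_VaR M \<alpha> \<longleftrightarrow>
    prob {\<omega>\<in>space M. X \<omega> + m / S0 * ST \<omega> < 0} \<le> \<alpha>" for m
  proof -
    let ?Y = "\<lambda>\<omega>\<in>space M. X \<omega> + m / S0 * ST \<omega>"
    obtain a b where ab: "\<And>\<omega>. \<omega> \<in> space M \<Longrightarrow> \<bar>X \<omega>\<bar> \<le> a" "\<And>\<omega>. \<omega> \<in> space M \<Longrightarrow> \<bar>ST \<omega>\<bar> \<le> b"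
      using X ST by (metis bounded_rvE)
    have "\<bar>X \<omega> + m / S0 * ST \<omega>\<bar> \<le> a + \<bar>m / S0\<bar> * b" if "\<omega> \<in> space M" for \<omega>
    proof -
      have "\<bar>X \<omega> + m / S0 * ST \<omega>\<bar> \<le> \<bar>X \<omega>\<bar> + \<bar>m / S0\<bar> * \<bar>ST \<omega>\<bar>"
        by (metis abs_mult abs_triangle_ineq)
      also have "\<dots> \<le> a + \<bar>m / S0\<bar> * b"
        using ab that by (intro add_mono mult_left_mono) auto
      finally show ?thesis .
    qed
    moreover have "(\<lambda>\<omega>. X \<omega> + m / S0 * ST \<omega>) \<in> borel_measurable M"
      using X ST by (auto simp: mspace_bounded_rv)
    ultimately have Y: "?Y \<in> mspace (bounded_rv M)"
      by (intro restrict_in_bounded_rv)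
    have "{\<omega>\<in>space M. ?Y \<omega> < 0} = {\<omega>\<in>space M. X \<omega> + m / S0 * ST \<omega> < 0}" by auto
    with Y show ?thesis
      by (simp add: acceptance_VaR_def VaR_le_0_iff mspace_bounded_rv)
  qed
  then show ?thesis by (simp add: risk_measure_def)
qed

section \<open>Sufficiency: Lipschitz continuity of the risk measure\<close>

lemma risk_measure_perturb:
  assumes ST: "ST \<in> mspace (bounded_rv M)" "AE \<omega> in M. \<epsilon> \<le> ST \<omega>"
    and "0 < S0" "0 < \<epsilon>" "0 \<le> d"
    and X: "X \<in> mspace (bounded_rv M)" and Y: "Y \<in> mspace (bounded_rv M)"
    and d: "\<And>\<omega>. \<omega> \<in> space M \<Longrightarrow> X \<omega> \<le> Y \<omega> + d"
    and x: "risk_measure M (acceptance_VaR M \<alpha>) (S0, ST) X = ereal x"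
    and y: "risk_measure M (acceptance_VaR M \<alpha>) (S0, ST) Y = ereal y"
  shows "y \<le> x + S0 / \<epsilon> * d"
proof -
  have [measurable]: "ST \<in> borel_measurable M" "X \<in> borel_measurable M" "Y \<in> borel_measurable M"
    using ST X Y by (auto simp: mspace_bounded_rv)
  have "y - S0 / \<epsilon> * d \<le> m" if m: "prob {\<omega>\<in>space M. X \<omega> + m / S0 * ST \<omega> < 0} \<le> \<alpha>" for m
  proof -
    \<comment> \<open>The extra capital buys \<open>d / \<epsilon>\<close> more units of the asset,
      which pay at least \<open>d\<close> wherever \<open>ST\<close> is at least \<epsilon>, hence
      almost surely.\<close>
    let ?m = "m + S0 / \<epsilon> * d"
    have le: "X \<omega> + m / S0 * ST \<omega> \<le> Y \<omega> + ?m / S0 * ST \<omega>" if "\<omega> \<in> space M" "\<epsilon> \<le> ST \<omega>" for \<omega>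
    proof -
      have "d * 1 \<le> d * (ST \<omega> / \<epsilon>)" using that assms(4,5) by (intro mult_left_mono) auto
      moreover have "?m / S0 * ST \<omega> = m / S0 * ST \<omega> + d * (ST \<omega> / \<epsilon>)"
        using assms(3,4) by (simp add: field_simps)
      ultimately show ?thesis using d[OF that(1)] by simp
    qed
    have "AE \<omega> in M. Y \<omega> + ?m / S0 * ST \<omega> < 0 \<longrightarrow> X \<omega> + m / S0 * ST \<omega> < 0"
      using ST(2) AE_space by eventually_elim (meson le le_less_trans)
    then have "prob {\<omega>\<in>space M. Y \<omega> + ?m / S0 * ST \<omega> < 0}
        \<le> prob {\<omega>\<in>space M. X \<omega> + m / S0 * ST \<omega> < 0}"
      by (intro finite_measure_mono_AE) auto
    then have "risk_measure M (acceptance_VaR M \<alpha>) (S0, ST) Y \<le> ereal ?m"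
      unfolding risk_measure_acceptance_VaR[OF Y ST(1)] using m by (intro Inf_lower) force
    with y show ?thesis by simp
  qed
  then have "ereal (y - S0 / \<epsilon> * d) \<le> risk_measure M (acceptance_VaR M \<alpha>) (S0, ST) X"
    unfolding risk_measure_acceptance_VaR[OF X ST(1)] by (intro Inf_greatest) auto
  with x show ?thesis by simp
qed

lemma continuous_risk_measure_if_ess_bounded_away:
  assumes "0 < S0" "ST \<in> mspace (bounded_rv M)"
    and fin: "finitely_valued M (risk_measure M (acceptance_VaR M \<alpha>) (S0, ST))"
    and "ess_bounded_away_from_zero M ST"
  shows "continuous_map (mtopology_of (bounded_rv M)) euclidean
           (risk_measure M (acceptance_VaR M \<alpha>) (S0, ST))"
proof -
  let ?\<rho> = "risk_measure M (acceptance_VaR M \<alpha>) (S0, ST)"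
  \<comment> \<open>The Lipschitz argument needs a real-valued function. By finiteness,
    \<open>r\<close> followed by \<open>ereal\<close> recovers the risk measure on the whole space,
    and \<open>ereal\<close> is continuous.\<close>
  define r where "r X = real_of_ereal (?\<rho> X)" for X
  have r: "?\<rho> X = ereal (r X)" if "X \<in> mspace (bounded_rv M)" for X
    using fin that by (auto simp: finitely_valued_def r_def ereal_real)
  have [measurable]: "ST \<in> borel_measurable M" using assms(2) by (simp add: mspace_bounded_rv)
  obtain \<epsilon> where "0 < \<epsilon>" "prob {\<omega>\<in>space M. \<epsilon> \<le> ST \<omega>} = 1"
    using assms(4) by (auto simp: ess_bounded_away_from_zero_def)
  then have AE: "AE \<omega> in M. \<epsilon> \<le> ST \<omega>"
    using prob_Collect_eq_1[of "\<lambda>\<omega>. \<epsilon> \<le> ST \<omega>"] by auto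
  have r_le: "r Y \<le> r X + S0 / \<epsilon> * mdist (bounded_rv M) X Y"
    if "X \<in> mspace (bounded_rv M)" "Y \<in> mspace (bounded_rv M)" for X Y
  proof (rule risk_measure_perturb[OF assms(2) AE assms(1) \<open>0 < \<epsilon>\<close> _ that _ r r])
    show "X \<omega> \<le> Y \<omega> + mdist (bounded_rv M) X Y" if "\<omega> \<in> space M" for \<omega>
      using abs_diff_le_mdist_bounded_rv[of X M Y \<omega>] that \<open>X \<in> _\<close> \<open>Y \<in> _\<close> by linarith
  qed (use that in auto)
  have "Lipschitz_continuous_map (bounded_rv M) euclidean_metric r"
    unfolding Lipschitz_continuous_map_def
  proof (intro conjI exI[of _ "S0 / \<epsilon>"] ballI)
    fix X Y assume "X \<in> mspace (bounded_rv M)" "Y \<in> mspace (bounded_rv M)"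
    then show "mdist euclidean_metric (r X) (r Y) \<le> S0 / \<epsilon> * mdist (bounded_rv M) X Y"
      using r_le[of X Y] r_le[of Y X] by (simp add: dist_real_def mdist_commute abs_le_iff)
  qed simp
  then have "continuous_map (mtopology_of (bounded_rv M)) euclideanreal r"
    using Lipschitz_continuous_imp_continuous_map by fastforce
  moreover have "continuous_map euclideanreal euclidean ereal"
    by (simp add: continuous_on_ereal continuous_on_id)
  ultimately have "continuous_map (mtopology_of (bounded_rv M)) euclidean (ereal \<circ> r)"
    by (rule continuous_map_compose)
  then show ?thesis
    by (rule continuous_map_eq) (simp add: r)
qed

section \<open>Necessity: discontinuity when the payoff is not bounded away from zero\<close>

lemma prob_payoff_pos_gt:
  assumes "0 < S0" "ST \<in> mspace (bounded_rv M)" "\<And>\<omega>. \<omega> \<in> space M \<Longrightarrow> 0 \<le> ST \<omega>"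
    and fin: "finitely_valued M (risk_measure M (acceptance_VaR M \<alpha>) (S0, ST))"
  shows "\<alpha> < prob {\<omega>\<in>space M. 0 < ST \<omega>}"
proof (rule ccontr)
  \<comment> \<open>Any position in the asset added to the constant 1 can lose only where
    \<open>ST\<close> is positive. If that event had probability at most \<alpha>, every
    \<open>m\<close> would be acceptable and the risk would be minus infinity.\<close>
  let ?X = "\<lambda>\<omega>\<in>space M. 1::real"
  have [measurable]: "ST \<in> borel_measurable M" using assms(2) by (simp add: mspace_bounded_rv)
  have X: "?X \<in> mspace (bounded_rv M)" by (rule restrict_in_bounded_rv[of _ _ 1]) auto
  assume *: "\<not> \<alpha> < prob {\<omega>\<in>space M. 0 < ST \<omega>}"
  have "prob {\<omega>\<in>space M. ?X \<omega> + m / S0 * ST \<omega> < 0} \<le> \<alpha>" for m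
  proof -
    have "ST \<omega> \<noteq> 0" if "?X \<omega> + m / S0 * ST \<omega> < 0" "\<omega> \<in> space M" for \<omega>
      using that by auto
    then have "prob {\<omega>\<in>space M. ?X \<omega> + m / S0 * ST \<omega> < 0} \<le> prob {\<omega>\<in>space M. 0 < ST \<omega>}"
      using assms(3) by (intro finite_measure_mono) (auto simp: less_le)
    with * show ?thesis by simp
  qed
  then have "risk_measure M (acceptance_VaR M \<alpha>) (S0, ST) ?X \<le> ereal m" for m
    unfolding risk_measure_acceptance_VaR[OF X assms(2)] by (intro Inf_lower) blast
  then have "risk_measure M (acceptance_VaR M \<alpha>) (S0, ST) ?X = - \<infinity>"
    by (rule ereal_bot)
  with fin X show False by (auto simp: finitely_valued_def)
qed

lemma ess_bounded_away_if_continuous_risk_measure: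
  assumes "nonatomic M" "0 < \<alpha>" "0 < S0" and ST: "ST \<in> mspace (bounded_rv M)"
    and nonneg: "\<And>\<omega>. \<omega> \<in> space M \<Longrightarrow> 0 \<le> ST \<omega>"
    and fin: "finitely_valued M (risk_measure M (acceptance_VaR M \<alpha>) (S0, ST))"
    and cont: "continuous_map (mtopology_of (bounded_rv M)) euclidean
           (risk_measure M (acceptance_VaR M \<alpha>) (S0, ST))"
  shows "ess_bounded_away_from_zero M ST"
proof (rule ccontr)
  let ?\<rho> = "risk_measure M (acceptance_VaR M \<alpha>) (S0, ST)"
  assume neg: "\<not> ess_bounded_away_from_zero M ST"
  have [measurable]: "ST \<in> borel_measurable M" using ST by (simp add: mspace_bounded_rv)
  have small: "0 < prob {\<omega>\<in>space M. ST \<omega> < e}" if "0 < e" for e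
  proof -
    have "prob {\<omega>\<in>space M. \<not> e \<le> ST \<omega>} = 1 - prob {\<omega>\<in>space M. e \<le> ST \<omega>}"
      by (rule prob_neg) auto
    moreover have "prob {\<omega>\<in>space M. e \<le> ST \<omega>} \<noteq> 1"
      using neg that by (auto simp: ess_bounded_away_from_zero_def)
    ultimately show ?thesis using prob_le_1[of "{\<omega>\<in>space M. e \<le> ST \<omega>}"]
      by (simp add: not_le less_le del: prob_le_1)
  qed
  obtain \<eta> where \<eta>: "0 < \<eta>" "\<alpha> \<le> prob {\<omega>\<in>space M. \<eta> \<le> ST \<omega>}"
  proof -
    \<comment> \<open>Since \<open>ST\<close> is positive with probability above \<alpha>, the value
      at risk of \<open>- ST\<close> is strictly positive. Any level \<open>m\<close> strictly
      between 0 and it still satisfies P[ST > m] > \<alpha>, and serves as \<eta>.\<close>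
    have "\<not> VaR M \<alpha> (\<lambda>\<omega>. - ST \<omega>) \<le> 0"
      using prob_payoff_pos_gt[OF assms(3) ST nonneg fin] by (simp add: VaR_le_0_iff)
    then obtain m where m: "0 < ereal m" "ereal m < VaR M \<alpha> (\<lambda>\<omega>. - ST \<omega>)"
      using ereal_dense2[of 0 "VaR M \<alpha> (\<lambda>\<omega>. - ST \<omega>)"] by (auto simp: not_le)
    have "\<alpha> < prob {\<omega>\<in>space M. - ST \<omega> + m < 0}"
    proof (rule ccontr)
      assume "\<not> \<alpha> < prob {\<omega>\<in>space M. - ST \<omega> + m < 0}"
      then have "VaR M \<alpha> (\<lambda>\<omega>. - ST \<omega>) \<le> ereal m"
        unfolding VaR_def by (intro Inf_lower) (auto simp: not_less)
      with m show False by simp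
    qed
    also have "\<dots> \<le> prob {\<omega>\<in>space M. m \<le> ST \<omega>}"
      by (intro finite_measure_mono) auto
    finally show ?thesis using m by (intro that[of m]) auto
  qed
  obtain D where D: "D \<in> sets M" "D \<subseteq> {\<omega>\<in>space M. \<eta> \<le> ST \<omega>}" "prob D = \<alpha>"
    by (rule nonatomic_subset_of_measure[OF assms(1) _ _ \<eta>(2)]) (use assms in auto)
  note D(1)[measurable]
  obtain b where b: "0 < b" "\<And>\<omega>. \<omega> \<in> space M \<Longrightarrow> \<bar>ST \<omega>\<bar> \<le> b" using bounded_rvE[OF ST] by blast
  \<comment> \<open>\<open>L\<close> bounds the payoff bought with one unit of capital, so less than
    one unit cannot make up the loss \<open>L\<close> on \<open>D\<close>.\<close>
  define L where "L = b / S0"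
  define X where "X \<delta> = (\<lambda>\<omega>\<in>space M. - L * indicator D \<omega> - \<delta>)" for \<delta> :: real
  have L: "0 < L" using b assms by (simp add: L_def)
  have X: "X \<delta> \<in> mspace (bounded_rv M)" for \<delta>
    unfolding X_def using L
    by (intro restrict_in_bounded_rv[of _ _ "L + \<bar>\<delta>\<bar>"]) (auto simp: indicator_def)
  \<comment> \<open>Without any capital the loss event is exactly \<open>D\<close>, whose
    probability \<alpha> is just tolerated.\<close>
  have "{\<omega>\<in>space M. X 0 \<omega> + 0 / S0 * ST \<omega> < 0} = D"
    using L D by (auto simp: X_def indicator_def split: if_splits)
  then have "?\<rho> (X 0) \<le> ereal 0"
    unfolding risk_measure_acceptance_VaR[OF X ST] using D(3)
    by (intro Inf_lower) force
  then have X0: "?\<rho> (X 0) < 1" by (simp add: zero_ereal_def[symmetric] le_less_trans[of _ 0])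
  have X\<delta>: "1 \<le> ?\<rho> (X \<delta>)" if "0 < \<delta>" for \<delta>
    unfolding risk_measure_acceptance_VaR[OF X ST]
  proof (intro Inf_greatest, clarsimp)
    fix m assume m: "prob {\<omega>\<in>space M. X \<delta> \<omega> + m * ST \<omega> / S0 < 0} \<le> \<alpha>"
    show "1 \<le> m"
    proof (rule ccontr)
      assume "\<not> 1 \<le> m"
      then have le: "m * ST \<omega> / S0 \<le> ST \<omega> / S0" if "\<omega> \<in> space M" for \<omega>
        using nonneg[OF that] assms(3) mult_right_mono[of m 1 "ST \<omega>"]
        by (intro divide_right_mono) auto
      \<comment> \<open>The bound \<eta> makes \<open>A\<close> disjoint from \<open>D\<close>. The
        bound \<open>\<delta> * S0\<close> keeps the payoff of less than one unit of capital below
        \<delta>, so the shift by \<delta> turns \<open>A\<close> into a loss event and the total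
        loss probability exceeds \<alpha>.\<close>
      define A where "A = {\<omega>\<in>space M. ST \<omega> < min \<eta> (\<delta> * S0)}"
      have A[measurable]: "A \<in> sets M" unfolding A_def by auto
      have "prob (D \<union> A) = prob D + prob A"
        using D by (intro finite_measure_Union) (auto simp: A_def)
      moreover have "0 < prob A"
        unfolding A_def using \<eta> that assms by (intro small) auto
      moreover have "prob (D \<union> A) \<le> prob {\<omega>\<in>space M. X \<delta> \<omega> + m * ST \<omega> / S0 < 0}"
      proof (rule finite_measure_mono)
        show "D \<union> A \<subseteq> {\<omega>\<in>space M. X \<delta> \<omega> + m * ST \<omega> / S0 < 0}"
        proof
          fix \<omega> assume \<omega>: "\<omega> \<in> D \<union> A"
          then have sp: "\<omega> \<in> space M" using D by (auto simp: A_def)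
          have "ST \<omega> / S0 \<le> L"
            using b(2)[OF sp] assms(3) by (auto simp: L_def intro!: divide_right_mono)
          moreover have "\<omega> \<in> D \<or> \<omega> \<notin> D \<and> ST \<omega> / S0 < \<delta>"
            using \<omega> assms(3) by (auto simp: A_def field_simps)
          ultimately show "\<omega> \<in> {\<omega>\<in>space M. X \<delta> \<omega> + m * ST \<omega> / S0 < 0}"
            using le[OF sp] sp \<open>0 < \<delta>\<close> by (auto simp: X_def indicator_def)
        qed
        have "X \<delta> \<in> borel_measurable M" using X by (simp add: mspace_bounded_rv)
        then show "{\<omega>\<in>space M. X \<delta> \<omega> + m * ST \<omega> / S0 < 0} \<in> sets M" by measurable
      qed
      ultimately show False using m D(3) by linarith
    qed
  qed
  interpret B: Metric_space "mspace (bounded_rv M)" "mdist (bounded_rv M)"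
    by (rule Metric_space_mspace_mdist)
  \<comment> \<open>The level 1 separates the risk of \<open>X 0\<close> from that of every
    \<open>X \<delta>\<close> with positive \<delta>. By continuity the risk would stay below 1 on a
    ball around \<open>X 0\<close>, yet \<open>X (e/2)\<close> lies in that ball at distance exactly
    \<open>e/2\<close>.\<close>
  have "openin (mtopology_of (bounded_rv M)) {Z \<in> mspace (bounded_rv M). ?\<rho> Z \<in> {..<1}}"
    using openin_continuous_map_preimage[OF cont, of "{..<1}"] by simp
  then obtain e where e: "0 < e"
    "B.mball (X 0) e \<subseteq> {Z \<in> mspace (bounded_rv M). ?\<rho> Z \<in> {..<1}}"
    using X X0 unfolding mtopology_of_def B.openin_mtopology by blast
  have "mdist (bounded_rv M) (X 0) (X (e/2)) = (SUP \<omega>\<in>space M. \<bar>X 0 \<omega> - X (e/2) \<omega>\<bar>)"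
    by (rule mdist_bounded_rv) (use X not_empty in auto)
  also have "\<dots> = (SUP \<omega>\<in>space M. e/2)"
    using e by (intro SUP_cong) (auto simp: X_def)
  also have "\<dots> = e/2" using not_empty by simp
  finally have "X (e/2) \<in> B.mball (X 0) e" using X e by auto
  with e X\<delta>[of "e/2"] show False by auto
qed

end

theorem proposition4p15:
  fixes M :: "'a measure" and \<alpha> S0 :: real and ST :: "'a \<Rightarrow> real"
  assumes "prob_space M"
    and "nonatomic M"
    and "0 < \<alpha>" and "\<alpha> < 1"
    and "traded_asset M (S0, ST)"
    and "finitely_valued M (risk_measure M (acceptance_VaR M \<alpha>) (S0, ST))"
  shows "continuous_map (mtopology_of (bounded_rv M)) euclidean
           (risk_measure M (acceptance_VaR M \<alpha>) (S0, ST))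
         \<longleftrightarrow> ess_bounded_away_from_zero M ST"
proof -
  interpret prob_space M by fact
  have "0 < S0" "ST \<in> mspace (bounded_rv M)" "\<And>\<omega>. \<omega> \<in> space M \<Longrightarrow> 0 \<le> ST \<omega>"
    using assms(5) by (auto simp: traded_asset_def)
  then show ?thesis
    using assms continuous_risk_measure_if_ess_bounded_away
      ess_bounded_away_if_continuous_risk_measure by blast
qed

end
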